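(* Let $N$ be a nonempty finite set, let $\delta\in\mathbb{N}$ with $\delta\ge 1$, and for each $j\in N$ let $l_j,u_j\in\mathbb{R}$ with $0\le l_j\le u_j<\infty$. Put $\Omega=\{x\in\mathbb{R}^{|N|}: 0\le l_j\le x_j\le u_j<\infty \text{ for all } j\in N\}$. Given a linear relaxation of the form $LP(\Omega)$ of a polynomial optimization problem of degree $\delta$, the bound-factor constraints imply the bounds on the RLT variables given by the products of the bounds of the original variables. That is, let $(X_J)_J$ be real numbers indexed by the multisets $J$ of elements of $N$ with $1\le |J|\le\delta$, where $X_{\{j\}}=x_j$ for $j\in N$, and suppose that all linearized bound-factor constraints of degree $\delta$ hold, i.e., for every pair of multisets $J_1,J_2$ of elements of $N$ with $|J_1|+|J_2|=\delta$, $$\Big[\prod_{j\in J_1}(x_j-l_j)\prod_{j\in J_2}(u_j-x_j)\Big]_L\ge 0 .$$ Then, for each monomial, i.e., for every multiset $J$ of elements of $N$ with $1\le|J|\le\delta$, $$\prod_{j\in J} l_j\ \le\ X_J\ \le\ \prod_{j\in J}u_j .$$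
   Context: A multiset of elements of $N$ is given by a multiplicity map $\mu:N\to\mathbb{N}\cup\{0\}$; its cardinality is $\sum_{j\in N}\mu(j)$, and products $\prod_{j\in J}$ over a multiset $J$ are taken with multiplicity (empty products equal $1$). Sums of multisets add multiplicities. To each multiset $J$ with $|J|\geq 2$ one associates a variable $X_J$ (an RLT variable), representing the monomial $\prod_{j\in J}x_j$; for $|J|=1$, $X_{\{j\}}=x_j$. For a polynomial $p(x)$ of degree at most $\delta$, its linearization $[p(x)]_L$ is the affine expression obtained by expanding $p$ into monomials and replacing every monomial $\prod_{j\in J}x_j$ with $|J|\ge 2$ by the variable $X_J$ (constants and degree-one monomials are kept). The linear relaxation $LP(\Omega)$ of a polynomial optimization problem of degree $\delta$ over $\Omega$ (minimize a polynomial subject to polynomial inequality and equality constraints and $x\in\Omega$, where $\delta$ is the maximum degree of the polynomials involved) is obtained by linearizing the objective and the constraints, keeping $x\in\Omega$, and adding all the linearized bound-factor constraints of degree $\delta$, i.e., those with $J_1+J_2$ of cardinality $\delta$.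
   Formalization: The formal theorem additionally assumes that δ = 1 or l_j < u_j for some j in N; without it the claim fails, e.g. N = {1}, l = u = 1, δ = 3, x = 1, X_{11} = 0, X_{111} = -2 satisfies all constraints but X_{11} < 1. *)

theory Defs
  imports Complex_Main "HOL-Library.Multiset" "HOL-Library.Poly_Mapping"
begin

text \<open>
  The real polynomial ring in variables indexed by \<open>'a\<close> is the monoid algebra over multisets: the
  multiset \<open>J\<close> is the monomial \<open>\<Prod>j\<in>#J. x j\<close>, addition of multisets is multiplication of monomials,
  and the multiplication of \<open>Poly_Mapping\<close> is the multiplication of polynomials.
\<close>

type_synonym 'a rpoly = "'a multiset \<Rightarrow>\<^sub>0 real"

definition pvar :: "'a \<Rightarrow> 'a rpoly" where
  "pvar j = Poly_Mapping.single {#j#} 1"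

definition pconst :: "real \<Rightarrow> 'a rpoly" where
  "pconst c = Poly_Mapping.single {#} c"

text \<open>
  Value of the linearization of \<open>p\<close> when the variable attached to a nonempty multiset \<open>J\<close> has the
  value \<open>X J\<close>; for singletons, \<open>X {#j#}\<close> is the original variable \<open>x j\<close>. The empty multiset is the
  constant monomial, whose coefficient is kept; the value \<open>X {#}\<close> is never used.
\<close>

definition linearize :: "('a multiset \<Rightarrow> real) \<Rightarrow> 'a rpoly \<Rightarrow> real" where
  "linearize X p =
     (\<Sum>J\<in>Poly_Mapping.keys p. Poly_Mapping.lookup p J * (if J = {#} then 1 else X J))"

definition bound_factor ::
  "('a \<Rightarrow> real) \<Rightarrow> ('a \<Rightarrow> real) \<Rightarrow> 'a multiset \<Rightarrow> 'a multiset \<Rightarrow> 'a rpoly" where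
  "bound_factor l u J1 J2 =
     (\<Prod>j\<in>#J1. pvar j - pconst (l j)) * (\<Prod>j\<in>#J2. pconst (u j) - pvar j)"

text \<open>
  If \<open>l j = u j\<close> for every \<open>j\<close>, all bound factors of degree \<open>\<delta>\<close> agree up to sign for each multiset
  \<open>J1 + J2\<close>, so the linearized constraints reduce to one equation for each \<open>X J\<close> of top degree and
  leave the variables of lower degree free. For \<open>\<delta> \<ge> 2\<close> they then do not imply the product bounds
  (for \<open>\<delta> \<ge> 3\<close> not even together with \<open>l j \<le> x j \<le> u j\<close>), which is why the theorem needs some
  \<open>l j < u j\<close> or \<open>\<delta> = 1\<close>.
\<close>

end

theory Submission imports Defs begin

text \<open>
  Linearization is a linear functional on polynomials that sends \<open>1\<close> to \<open>1\<close> and the monomial of a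
  nonempty multiset \<open>J\<close> to \<open>X J\<close>. Everything thus follows from writing polynomials as combinations of
  bound factors with nonnegative coefficients.

  Nonnegativity first descends to lower degrees: if \<open>l k < u k\<close>, then
  \<open>(x\<^sub>k - l\<^sub>k) + (u\<^sub>k - x\<^sub>k) = u\<^sub>k - l\<^sub>k > 0\<close> exhibits a positive multiple of each bound factor of
  degree \<open>d\<close> as the sum of two of degree \<open>d + 1\<close> (\<open>bound_factor_lower_degree\<close>). For
  \<open>\<delta> = 1\<close> the only lower degree is \<open>0\<close>, where the only bound factor is \<open>1\<close>.

  Secondly, \<open>x\<^sub>j = (x\<^sub>j - l\<^sub>j) + l\<^sub>j\<close> with \<open>l\<^sub>j \<ge> 0\<close> shows that a bound factor multiplied by a monomial,
  of total degree at most \<open>\<delta>\<close>, is still nonnegative after linearization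
  (\<open>linearize_monomial_times_bound_factor_nonneg\<close>). The bounds
  on \<open>X J\<close> then follow by adding one element to \<open>J\<close> at a time, through
  \<open>x\<^sub>j x\<^sup>J - l\<^sub>j l\<^sup>J = (x\<^sub>j - l\<^sub>j) x\<^sup>J + l\<^sub>j (x\<^sup>J - l\<^sup>J)\<close> and
  \<open>u\<^sub>j u\<^sup>J - x\<^sub>j x\<^sup>J = (u\<^sub>j - x\<^sub>j) x\<^sup>J + u\<^sub>j (u\<^sup>J - x\<^sup>J)\<close>.
\<close>

lemma linearize_eq_sum_superset:
  assumes "finite A" and "Poly_Mapping.keys p \<subseteq> A"
  shows "linearize X p =
    (\<Sum>J\<in>A. Poly_Mapping.lookup p J * (if J = {#} then 1 else X J))"
  unfolding linearize_def
  by (rule sum.mono_neutral_left) (use assms in \<open>auto simp: in_keys_iff\<close>)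

lemma linearize_add: "linearize X (p + q) = linearize X p + linearize X q"
proof -
  let ?A = "Poly_Mapping.keys p \<union> Poly_Mapping.keys q"
  have "Poly_Mapping.keys (p + q) \<subseteq> ?A"
    by (rule Poly_Mapping.keys_add)
  then show ?thesis
    by (simp add: linearize_eq_sum_superset[of ?A] lookup_add distrib_right sum.distrib)
qed

lemma lookup_pconst_times:
  "Poly_Mapping.lookup (pconst c * p) J = c * Poly_Mapping.lookup p J"
  unfolding pconst_def mult_map_scale_conv_mult[symmetric]
  by (simp add: Poly_Mapping.map.rep_eq when_def)

lemma linearize_pconst_times: "linearize X (pconst c * p) = c * linearize X p"
proof -
  have "Poly_Mapping.keys (pconst c * p) \<subseteq> Poly_Mapping.keys p"
    by (auto simp: in_keys_iff lookup_pconst_times)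
  then show ?thesis
    by (simp add: linearize_eq_sum_superset[of "Poly_Mapping.keys p"] lookup_pconst_times
        sum_distrib_left mult.assoc)
qed

definition monomial :: "'a multiset \<Rightarrow> 'a rpoly" where
  "monomial M = Poly_Mapping.single M 1"

lemma monomial_empty: "monomial {#} = 1"
  by (simp add: monomial_def)

lemma monomial_add_mset: "monomial (add_mset j M) = pvar j * monomial M"
  by (simp add: monomial_def pvar_def mult_single)

lemma linearize_monomial: "linearize X (monomial J) = (if J = {#} then 1 else X J)"
  by (simp add: linearize_def monomial_def)

lemma pconst_diff: "pconst (a - b) = pconst a - pconst b"
  by (simp add: pconst_def single_diff)

lemma bound_factor_empty: "bound_factor l u {#} {#} = 1"
  by (simp add: bound_factor_def)

lemma bound_factor_add_mset_left:
  "bound_factor l u (add_mset j J1) J2 = (pvar j - pconst (l j)) * bound_factor l u J1 J2"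
  by (simp add: bound_factor_def mult.assoc)

lemma bound_factor_add_mset_right:
  "bound_factor l u J1 (add_mset j J2) = (pconst (u j) - pvar j) * bound_factor l u J1 J2"
  by (simp add: bound_factor_def mult.left_commute)

text \<open>The sum of the two factors at \<open>k\<close> is the constant \<open>u k - l k\<close>, so one degree can be cancelled.\<close>

lemma bound_factor_lower_degree:
  assumes "l k < u k"
    and left: "0 \<le> linearize X (bound_factor l u (add_mset k J1) J2)"
    and right: "0 \<le> linearize X (bound_factor l u J1 (add_mset k J2))"
  shows "0 \<le> linearize X (bound_factor l u J1 J2)"
proof -
  have "bound_factor l u (add_mset k J1) J2 + bound_factor l u J1 (add_mset k J2) =
      pconst (u k - l k) * bound_factor l u J1 J2"
    by (simp add: bound_factor_add_mset_left bound_factor_add_mset_right pconst_diff algebra_simps)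
  then have "(u k - l k) * linearize X (bound_factor l u J1 J2) =
      linearize X (bound_factor l u (add_mset k J1) J2)
      + linearize X (bound_factor l u J1 (add_mset k J2))"
    by (simp flip: linearize_add linearize_pconst_times)
  then have "0 \<le> (u k - l k) * linearize X (bound_factor l u J1 J2)"
    using left right by simp
  then show ?thesis
    using assms(1) by (simp add: zero_le_mult_iff)
qed

lemma bound_factors_nonneg_up_to_degree:
  assumes top: "\<And>J1 J2. set_mset J1 \<subseteq> N \<Longrightarrow> set_mset J2 \<subseteq> N \<Longrightarrow> size J1 + size J2 = \<delta> \<Longrightarrow>
      0 \<le> linearize X (bound_factor l u J1 J2)"
    and nondegenerate: "\<delta> = 1 \<or> (\<exists>k\<in>N. l k < u k)"
    and "set_mset J1 \<subseteq> N" and "set_mset J2 \<subseteq> N" and "size J1 + size J2 \<le> \<delta>"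
  shows "0 \<le> linearize X (bound_factor l u J1 J2)"
proof (cases "\<exists>k\<in>N. l k < u k")
  case True
  then obtain k where k: "k \<in> N" "l k < u k" by blast
  from assms(3-5) show ?thesis
  proof (induction "\<delta> - (size J1 + size J2)" arbitrary: J1 J2)
    case 0
    then show ?case by (simp add: top)
  next
    case (Suc n)
    have "0 \<le> linearize X (bound_factor l u (add_mset k J1) J2)"
      by (rule Suc.hyps(1)) (use Suc.hyps(2) Suc.prems k(1) in auto)
    moreover have "0 \<le> linearize X (bound_factor l u J1 (add_mset k J2))"
      by (rule Suc.hyps(1)) (use Suc.hyps(2) Suc.prems k(1) in auto)
    ultimately show ?case
      using k(2) bound_factor_lower_degree[of l k u X J1 J2] by blast
  qed
next
  case False
  with nondegenerate have "\<delta> = 1" by blast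
  show ?thesis
  proof (cases "size J1 + size J2 = \<delta>")
    case True
    then show ?thesis using assms(3,4) by (simp add: top)
  next
    case False
    then have "size J1 + size J2 = 0"
      using assms(5) \<open>\<delta> = 1\<close> by linarith
    then have "J1 = {#}" and "J2 = {#}"
      by simp_all
    then show ?thesis
      using linearize_monomial[of X "{#}"] by (simp add: bound_factor_empty monomial_empty)
  qed
qed

text \<open>
  Since \<open>l j \<ge> 0\<close>, each variable \<open>x\<^sub>j = (x\<^sub>j - l\<^sub>j) + l\<^sub>j\<close> of the monomial can be absorbed into the bound
  factor, at the cost of terms of the same or lower degree.
\<close>

lemma linearize_monomial_times_bound_factor_nonneg:
  assumes nonneg: "\<And>J1 J2. set_mset J1 \<subseteq> N \<Longrightarrow> set_mset J2 \<subseteq> N \<Longrightarrow> size J1 + size J2 \<le> \<delta> \<Longrightarrow>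
      0 \<le> linearize X (bound_factor l u J1 J2)"
    and l_nonneg: "\<And>j. j \<in> N \<Longrightarrow> 0 \<le> l j"
    and "set_mset M \<subseteq> N" and "set_mset J1 \<subseteq> N" and "set_mset J2 \<subseteq> N"
    and "size M + size J1 + size J2 \<le> \<delta>"
  shows "0 \<le> linearize X (monomial M * bound_factor l u J1 J2)"
  using assms(3-6)
proof (induction M arbitrary: J1)
  case empty
  then show ?case by (simp add: monomial_empty nonneg)
next
  case (add j M)
  have "monomial (add_mset j M) * bound_factor l u J1 J2 =
      monomial M * bound_factor l u (add_mset j J1) J2
      + pconst (l j) * (monomial M * bound_factor l u J1 J2)"
    by (simp add: monomial_add_mset bound_factor_add_mset_left algebra_simps)
  moreover have "0 \<le> linearize X (monomial M * bound_factor l u (add_mset j J1) J2)"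
    by (rule add.IH) (use add.prems in auto)
  moreover have "0 \<le> linearize X (monomial M * bound_factor l u J1 J2)"
    by (rule add.IH) (use add.prems in auto)
  ultimately show ?case
    using add.prems(1) l_nonneg by (simp add: linearize_add linearize_pconst_times)
qed

text \<open>
  Stated for the linearized monomial rather than for \<open>X J\<close>, the bounds also cover the empty multiset,
  where all three quantities are \<open>1\<close>; this is where the induction starts.
\<close>

lemma linearize_monomial_bounds:
  assumes nonneg: "\<And>J1 J2. set_mset J1 \<subseteq> N \<Longrightarrow> set_mset J2 \<subseteq> N \<Longrightarrow> size J1 + size J2 \<le> \<delta> \<Longrightarrow>
      0 \<le> linearize X (bound_factor l u J1 J2)"
    and bounds: "\<And>j. j \<in> N \<Longrightarrow> 0 \<le> l j \<and> l j \<le> u j"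
    and "set_mset J \<subseteq> N" and "size J \<le> \<delta>"
  shows "(\<Prod>j\<in>#J. l j) \<le> linearize X (monomial J) \<and> linearize X (monomial J) \<le> (\<Prod>j\<in>#J. u j)"
  using assms(3,4)
proof (induction J)
  case empty
  then show ?case by (simp add: linearize_monomial)
next
  case (add j J)
  let ?m = "linearize X (monomial J)"
  let ?m' = "linearize X (monomial (add_mset j J))"
  have j: "0 \<le> l j" "0 \<le> u j"
    using bounds[of j] add.prems(1) by auto
  have IH: "(\<Prod>i\<in>#J. l i) \<le> ?m" "?m \<le> (\<Prod>i\<in>#J. u i)"
    using add by auto
  have "0 \<le> linearize X (monomial J * bound_factor l u {#j#} {#})"
    by (rule linearize_monomial_times_bound_factor_nonneg[where N = N and \<delta> = \<delta>])
      (use nonneg bounds add.prems in auto)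
  moreover have "monomial (add_mset j J) =
      monomial J * bound_factor l u {#j#} {#} + pconst (l j) * monomial J"
    by (simp add: monomial_add_mset bound_factor_add_mset_left bound_factor_empty algebra_simps)
  ultimately have lower: "l j * ?m \<le> ?m'"
    by (simp add: linearize_add linearize_pconst_times)
  have "0 \<le> linearize X (monomial J * bound_factor l u {#} {#j#})"
    by (rule linearize_monomial_times_bound_factor_nonneg[where N = N and \<delta> = \<delta>])
      (use nonneg bounds add.prems in auto)
  moreover have "monomial (add_mset j J) + monomial J * bound_factor l u {#} {#j#} =
      pconst (u j) * monomial J"
    by (simp add: monomial_add_mset bound_factor_add_mset_right bound_factor_empty algebra_simps)
  then have "?m' + linearize X (monomial J * bound_factor l u {#} {#j#}) = u j * ?m"
    by (simp flip: linearize_add linearize_pconst_times)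
  ultimately have upper: "?m' \<le> u j * ?m"
    by simp
  show ?case
    using lower upper mult_left_mono[OF IH(1) j(1)] mult_left_mono[OF IH(2) j(2)] by simp
qed

theorem theorem1:
  fixes N :: "'a set" and \<delta> :: nat
    and l u x :: "'a \<Rightarrow> real" and X :: "'a multiset \<Rightarrow> real"
  assumes "finite N" and "N \<noteq> {}" and "\<delta> \<ge> 1"
    and bounds: "\<And>j. j \<in> N \<Longrightarrow> 0 \<le> l j \<and> l j \<le> u j"
    and nondegenerate: "\<delta> = 1 \<or> (\<exists>j\<in>N. l j < u j)"
    and singleton: "\<And>j. j \<in> N \<Longrightarrow> X {#j#} = x j"
    and bound_factor_constraints:
      "\<And>J1 J2. set_mset J1 \<subseteq> N \<Longrightarrow> set_mset J2 \<subseteq> N \<Longrightarrow> size J1 + size J2 = \<delta> \<Longrightarrow>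
         linearize X (bound_factor l u J1 J2) \<ge> 0"
  shows "\<forall>J. set_mset J \<subseteq> N \<and> 1 \<le> size J \<and> size J \<le> \<delta> \<longrightarrow>
           (\<Prod>j\<in>#J. l j) \<le> X J \<and> X J \<le> (\<Prod>j\<in>#J. u j)"
proof (intro allI impI)
  fix J assume J: "set_mset J \<subseteq> N \<and> 1 \<le> size J \<and> size J \<le> \<delta>"
  have "(\<Prod>j\<in>#J. l j) \<le> linearize X (monomial J) \<and> linearize X (monomial J) \<le> (\<Prod>j\<in>#J. u j)"
  proof (rule linearize_monomial_bounds[where N = N and \<delta> = \<delta>])
    show "0 \<le> linearize X (bound_factor l u J1 J2)"
      if "set_mset J1 \<subseteq> N" "set_mset J2 \<subseteq> N" "size J1 + size J2 \<le> \<delta>" for J1 J2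
      using bound_factors_nonneg_up_to_degree[OF bound_factor_constraints nondegenerate that] .
  qed (use bounds J in auto)
  moreover have "linearize X (monomial J) = X J"
    using J by (auto simp: linearize_monomial)
  ultimately show "(\<Prod>j\<in>#J. l j) \<le> X J \<and> X J \<le> (\<Prod>j\<in>#J. u j)"
    by simp
qed

end
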